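(* Suppose $\max\left\{\frac{|\delta+\mu|}{1+\beta},\frac{|\delta-\mu|}{1-\beta}\right\}\rho(G)<1$, $\mu<\beta\delta$, and $x^{A0}>\mathbf 0$, $x^{B0}>\mathbf 0$. Then the policy $$(p^{A*}_{\mathrm R},p^{B*}_{\mathrm R}):=(p^{A0}+\rho^{\max}+b,\ p^{B0}-\rho^{\max}),$$ which imposes maximum penalties and offers maximum premiums, is the policy that minimizes aggregate unsustainable effort $\sum_ix_i^{B*}$ over the set of all feasible policies of $\boldsymbol P_{\mathrm R}$. Under this policy every agent's unsustainable effort vanishes in the post-intervention equilibrium, i.e. $\sum_{i=1}^nx_i^{B*}=0$, if $\rho^{\max}\ge\rho^0$ and $b\ge b^0$, where $(\rho^0,b^0)\in\mathbb R^n\times\mathbb R^n$ is any pair of vectors satisfying $$\rho^0=\tfrac12(M^-)^{-1}\big(M^+p^{B0}-p^{A0}-M_\Delta b^0\big).$$ Moreover, if $\rho^{\max}$ and $b$ satisfy the budget-penalty sufficiency condition $$\rho^{\max}+\frac b2\ge p^{B0}-p^{A0},$$ then $(p^{A*}_{\mathrm R},p^{B*}_{\mathrm R})$ is also the optimal solution of $\boldsymbol P_{\mathrm R}$, and under this policy no agent's post-intervention utility is less than their pre-intervention utility.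
   Context: There are $n$ agents. $G=(g_{ij})\in\{0,1\}^{n\times n}$ is the symmetric, zero-diagonal adjacency matrix of an undirected graph; $\rho(G)$ is its spectral radius; $\beta\in(0,1)$, $\delta>0$, $\mu>0$. Inequalities are entrywise. Let $$M^+:=((1+\beta)I-(\delta+\mu)G)^{-1},\quad M^-:=((1-\beta)I-(\delta-\mu)G)^{-1},\quad M_\Delta:=M^--M^+ .$$ Given prices $(p^A,p^B)$, agent $i$ choosing $(x_i^A,x_i^B)\in\mathbb R_{\ge0}^2$ has utility $$u_i(x^A,x^B;p^A,p^B)=p_i^Ax_i^A+p_i^Bx_i^B-\tfrac12(x_i^A)^2-\tfrac12(x_i^B)^2-\beta x_i^Ax_i^B+\delta\sum_jg_{ij}(x_i^Ax_j^A+x_i^Bx_j^B)+\mu\sum_jg_{ij}(x_i^Ax_j^B+x_i^Bx_j^A).$$ For a policy $(p^A,p^B)$, the post-intervention equilibrium $(x^{A*},x^{B*})$ is the Nash equilibrium of this game (efforts constrained to be non-negative) with positive effort levels in activity $A$. It is given by $x^{A*}=\frac12((M^++M^-)p^A+(M^+-M^-)p^B)$, $x^{B*}=\frac12((M^+-M^-)p^A+(M^++M^-)p^B)$ when these expressions are non-negative. Pre-intervention prices are $p^{A0},p^{B0}\in\mathbb R^n_{\ge0}$, and $(x^{A0},x^{B0})$ is the equilibrium at these prices; the pre-intervention utility of agent $i$ is $u_i(x^{A0},x^{B0};p^{A0},p^{B0})$. Problem $\boldsymbol P_{\mathrm R}$: maximize over $(p^A,p^B)$ the welfare $\sum_iu_i(x^{A*},x^{B*};p^A,p^B)$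 subject to $\sum_ix_i^{B*}\le\tau^B$, $p^A\ge p^{A0}$, $p^{B0}-\rho^{\max}\le p^B\le p^{B0}$, and $p^A+p^B\le p^{A0}+p^{B0}+b$. Here $\tau^B\ge0$ is a tolerance, $\rho^{\max}$ with $\mathbf 0\le\rho^{\max}\le p^{B0}$ is the vector of maximum per-unit penalties, and $b\in\mathbb R^n_{\ge0}$ is the vector of price-adjustment budgets.
   Formalization: The equation for ρ⁰ is corrected to ρ⁰ = ½(M⁻)⁻¹((M⁺+M⁻)p^{B0} − M_Δ p^{A0} − M_Δ b⁰), the printed one being false; optimality is claimed when P_R has a feasible policy, and "the" minimizer/optimal solution means "a" (uniqueness fails in general). *)

theory Defs
  imports "HOL-Analysis.Analysis"
begin

text \<open>
  Agents are the elements of a finite type. Effort profiles and price policies are pairs whose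
  first component belongs to activity A (sustainable) and whose second component belongs to
  activity B (unsustainable). The order \<open>\<le>\<close> on vectors is the entrywise one. The library's \<open><\<close> on
  vectors is not entrywise strict, so strict positivity is always spelled out by index.
\<close>

type_synonym 'n profile = "(real ^ 'n) \<times> (real ^ 'n)"

definition adjacency_matrix :: "real ^ 'n ^ 'n \<Rightarrow> bool" where
  "adjacency_matrix G \<longleftrightarrow>
     (\<forall>i j. G $ i $ j \<in> {0, 1}) \<and> (\<forall>i j. G $ i $ j = G $ j $ i) \<and> (\<forall>i. G $ i $ i = 0)"

definition complex_spectrum :: "real ^ 'n ^ 'n \<Rightarrow> complex set" where
  "complex_spectrum A = {z. \<exists>v. v \<noteq> 0 \<and> map_matrix complex_of_real A *v v = z *s v}"

text \<open>The spectrum is finite and nonempty, so the supremum is a maximum.\<close>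

definition spectral_radius :: "real ^ 'n ^ 'n \<Rightarrow> real" where
  "spectral_radius A = (SUP z\<in>complex_spectrum A. cmod z)"

definition M_plus :: "real ^ 'n ^ 'n \<Rightarrow> real \<Rightarrow> real \<Rightarrow> real \<Rightarrow> real ^ 'n ^ 'n" where
  "M_plus G \<beta> \<delta> \<mu> = matrix_inv ((1 + \<beta>) *\<^sub>R mat 1 - (\<delta> + \<mu>) *\<^sub>R G)"

definition M_minus :: "real ^ 'n ^ 'n \<Rightarrow> real \<Rightarrow> real \<Rightarrow> real \<Rightarrow> real ^ 'n ^ 'n" where
  "M_minus G \<beta> \<delta> \<mu> = matrix_inv ((1 - \<beta>) *\<^sub>R mat 1 - (\<delta> - \<mu>) *\<^sub>R G)"

definition M_Delta :: "real ^ 'n ^ 'n \<Rightarrow> real \<Rightarrow> real \<Rightarrow> real \<Rightarrow> real ^ 'n ^ 'n" where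
  "M_Delta G \<beta> \<delta> \<mu> = M_minus G \<beta> \<delta> \<mu> - M_plus G \<beta> \<delta> \<mu>"

fun utility ::
  "real ^ 'n ^ 'n \<Rightarrow> real \<Rightarrow> real \<Rightarrow> real \<Rightarrow> ('n::finite) profile \<Rightarrow> ('n::finite) profile \<Rightarrow> 'n \<Rightarrow> real" where
  "utility G \<beta> \<delta> \<mu> (xA, xB) (pA, pB) i =
     pA $ i * xA $ i + pB $ i * xB $ i
     - 1 / 2 * (xA $ i)\<^sup>2 - 1 / 2 * (xB $ i)\<^sup>2 - \<beta> * xA $ i * xB $ i
     + \<delta> * (\<Sum>j\<in>UNIV. G $ i $ j * (xA $ i * xA $ j + xB $ i * xB $ j))
     + \<mu> * (\<Sum>j\<in>UNIV. G $ i $ j * (xA $ i * xB $ j + xB $ i * xA $ j))"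

fun deviate :: "('n::finite) profile \<Rightarrow> 'n \<Rightarrow> real \<Rightarrow> real \<Rightarrow> ('n::finite) profile" where
  "deviate (xA, xB) i a c =
     ((\<chi> j. if j = i then a else xA $ j), (\<chi> j. if j = i then c else xB $ j))"

definition nash ::
  "real ^ 'n ^ 'n \<Rightarrow> real \<Rightarrow> real \<Rightarrow> real \<Rightarrow> ('n::finite) profile \<Rightarrow> ('n::finite) profile \<Rightarrow> bool" where
  "nash G \<beta> \<delta> \<mu> p x \<longleftrightarrow>
     0 \<le> fst x \<and> 0 \<le> snd x \<and>
     (\<forall>i a c. 0 \<le> a \<longrightarrow> 0 \<le> c \<longrightarrow>
        utility G \<beta> \<delta> \<mu> (deviate x i a c) p i \<le> utility G \<beta> \<delta> \<mu> x p i)"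

definition equilibrium ::
  "real ^ 'n ^ 'n \<Rightarrow> real \<Rightarrow> real \<Rightarrow> real \<Rightarrow> ('n::finite) profile \<Rightarrow> ('n::finite) profile \<Rightarrow> bool" where
  "equilibrium G \<beta> \<delta> \<mu> p x \<longleftrightarrow> nash G \<beta> \<delta> \<mu> p x \<and> (\<forall>i. 0 < fst x $ i)"

text \<open>Meaningful only for policies that admit exactly one equilibrium.\<close>

definition outcome ::
  "real ^ 'n ^ 'n \<Rightarrow> real \<Rightarrow> real \<Rightarrow> real \<Rightarrow> ('n::finite) profile \<Rightarrow> ('n::finite) profile" where
  "outcome G \<beta> \<delta> \<mu> p = (THE x. equilibrium G \<beta> \<delta> \<mu> p x)"

definition total_effort_B :: "real ^ 'n ^ 'n \<Rightarrow> real \<Rightarrow> real \<Rightarrow> real \<Rightarrow> ('n::finite) profile \<Rightarrow> real" where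
  "total_effort_B G \<beta> \<delta> \<mu> p = (\<Sum>i\<in>UNIV. snd (outcome G \<beta> \<delta> \<mu> p) $ i)"

definition welfare :: "real ^ 'n ^ 'n \<Rightarrow> real \<Rightarrow> real \<Rightarrow> real \<Rightarrow> ('n::finite) profile \<Rightarrow> real" where
  "welfare G \<beta> \<delta> \<mu> p = (\<Sum>i\<in>UNIV. utility G \<beta> \<delta> \<mu> (outcome G \<beta> \<delta> \<mu> p) p i)"

fun price_constraints ::
  "('n::finite) profile \<Rightarrow> real ^ 'n \<Rightarrow> real ^ 'n \<Rightarrow> ('n::finite) profile \<Rightarrow> bool" where
  "price_constraints (pA0, pB0) \<rho>max b (pA, pB) \<longleftrightarrow>
     pA0 \<le> pA \<and> pB0 - \<rho>max \<le> pB \<and> pB \<le> pB0 \<and> pA + pB \<le> pA0 + pB0 + b"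

definition feasible ::
  "real ^ 'n ^ 'n \<Rightarrow> real \<Rightarrow> real \<Rightarrow> real \<Rightarrow> ('n::finite) profile \<Rightarrow> real ^ 'n \<Rightarrow> real ^ 'n \<Rightarrow> real
     \<Rightarrow> ('n::finite) profile \<Rightarrow> bool" where
  "feasible G \<beta> \<delta> \<mu> p0 \<rho>max b \<tau>B p \<longleftrightarrow>
     total_effort_B G \<beta> \<delta> \<mu> p \<le> \<tau>B \<and> price_constraints p0 \<rho>max b p"

fun max_policy :: "('n::finite) profile \<Rightarrow> real ^ 'n \<Rightarrow> real ^ 'n \<Rightarrow> ('n::finite) profile" where
  "max_policy (pA0, pB0) \<rho>max b = (pA0 + \<rho>max + b, pB0 - \<rho>max)"

end

theory Submission
  imports Defs
begin

text \<open>
  Every price policy under consideration weakly raises the prices of activity A and lowers those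
  of activity B, relative to prices at which all agents are active in A. The efforts \<open>x\<close> in activity
  A are then always positive and solve linear equations. Eliminating them leaves a linear
  complementarity problem for the efforts \<open>y\<close> in activity B, whose matrix is the Schur complement of
  the two-activity game (\<open>equilibrium_iff_lcp\<close>). The spectral condition makes this matrix positive
  definite, and \<open>\<mu> < \<beta> * \<delta>\<close> makes its off-diagonal entries nonpositive and the vector of the
  problem increasing in the prices of A (\<open>reduced_pd\<close>, \<open>crowding_nonneg\<close>).

  For such matrices one minimum principle does all the work: a vector \<open>e\<close> is nonnegative as soon as,
  at every coordinate, either \<open>e\<close> or \<open>A *v e\<close> is nonnegative
  (\<open>positive_definite_Z_minimum_principle\<close>). It shows that the complementarity problem has
  exactly one solution and that this solution decreases with the prices of A and increases with
  those of B (\<open>equilibrium_ex1\<close>, \<open>equilibrium_mono\<close>). Maximum penalties together with maximum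
  premiums are extreme in both directions, so they minimise unsustainable effort and are feasible
  whenever anything is. At the threshold \<open>(\<rho>0, b0)\<close> the vector of the complementarity problem is
  zero, and from there on it is nonnegative, so that activity B vanishes
  (\<open>zero_unsustainable_effort\<close>).

  In equilibrium the utility of an agent equals
  \<open>((1 + \<beta>) * (x + y)\<^sup>2 + (1 - \<beta>) * (x - y)\<^sup>2) / 4\<close>. The policy maximises \<open>x + y\<close>, since it
  also maximises the sum of the prices, and it maximises \<open>x - y\<close>. The sufficiency condition
  ensures that its \<open>x - y\<close> dominates the \<open>y - x\<close> of the other policies too. Thus each single agent
  does best under this policy (\<open>utility_mono\<close>), which gives the claims on welfare and on individual
  utilities at once.
\<close>

section \<open>Symmetric matrices and the spectral radius\<close>

lemma inner_matrix_vector_symmetric: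
  fixes A :: "real ^ 'n ^ 'n"
  assumes "\<forall>i j. A $ i $ j = A $ j $ i"
  shows "x \<bullet> (A *v y) = y \<bullet> (A *v x)"
proof -
  have "transpose A = A"
    using assms by (simp add: transpose_def vec_eq_iff)
  then have "x \<bullet> (A *v y) = (A *v x) \<bullet> y"
    by (metis dot_lmul_matrix transpose_matrix_vector)
  then show ?thesis
    by (simp add: inner_commute)
qed

text \<open>
  The eigenvalue equation, read at a coordinate where the eigenvector has the largest modulus,
  bounds the eigenvalue by a row sum of absolute values.
\<close>

lemma bdd_above_cmod_complex_spectrum:
  fixes A :: "real ^ 'n ^ 'n"
  shows "bdd_above (cmod ` complex_spectrum A)"
proof (rule bdd_aboveI2)
  fix z assume "z \<in> complex_spectrum A"
  then obtain v where v: "v \<noteq> 0" "map_matrix complex_of_real A *v v = z *s v"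
    by (auto simp: complex_spectrum_def)
  obtain i where i: "cmod (v $ i) = Max (range (\<lambda>j. cmod (v $ j)))"
    using Max_in[of "range (\<lambda>j. cmod (v $ j))"] by (auto simp: image_iff)
  have max: "cmod (v $ j) \<le> cmod (v $ i)" for j
    unfolding i by (rule Max_ge) auto
  obtain k where "v $ k \<noteq> 0"
    using v(1) by (auto simp: vec_eq_iff)
  then have pos: "0 < cmod (v $ i)"
    using max[of k] by (metis norm_le_zero_iff not_le order_trans)
  have "z * v $ i = (\<Sum>j\<in>UNIV. complex_of_real (A $ i $ j) * v $ j)"
    using arg_cong[OF v(2), of "\<lambda>w. w $ i"] by (simp add: matrix_vector_mult_def)
  then have "cmod z * cmod (v $ i) = cmod (\<Sum>j\<in>UNIV. complex_of_real (A $ i $ j) * v $ j)"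
    by (metis norm_mult)
  also have "\<dots> \<le> (\<Sum>j\<in>UNIV. \<bar>A $ i $ j\<bar> * cmod (v $ i))"
    by (rule sum_norm_le) (auto simp: norm_mult intro!: mult_left_mono max)
  also have "\<dots> = (\<Sum>j\<in>UNIV. \<bar>A $ i $ j\<bar>) * cmod (v $ i)"
    by (simp add: sum_distrib_right)
  also have "\<dots> \<le> (\<Sum>i\<in>UNIV. \<Sum>j\<in>UNIV. \<bar>A $ i $ j\<bar>) * cmod (v $ i)"
    by (intro mult_right_mono member_le_sum sum_nonneg) auto
  finally show "cmod z \<le> (\<Sum>i\<in>UNIV. \<Sum>j\<in>UNIV. \<bar>A $ i $ j\<bar>)"
    using pos by simp
qed

text \<open>
  The spectral radius is a supremum over the complex spectrum, so a real eigenvector has to be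
  viewed as a complex one, and the supremum is an upper bound because the spectrum is bounded.
\<close>

lemma real_eigenvalue_le_spectral_radius:
  fixes A :: "real ^ 'n ^ 'n"
  assumes "A *v v = l *\<^sub>R v" "v \<noteq> 0"
  shows "l \<le> spectral_radius A"
proof -
  let ?w = "\<chi> i. complex_of_real (v $ i)"
  have "map_matrix complex_of_real A *v ?w = complex_of_real l *s ?w"
  proof (rule vec_eq_iff[THEN iffD2], rule allI)
    fix i
    have "(\<Sum>j\<in>UNIV. A $ i $ j * v $ j) = l * v $ i"
      using arg_cong[OF assms(1), of "\<lambda>w. w $ i"] by (simp add: matrix_vector_mult_def)
    then have "complex_of_real (\<Sum>j\<in>UNIV. A $ i $ j * v $ j) = complex_of_real (l * v $ i)"
      by simp
    then show "(map_matrix complex_of_real A *v ?w) $ i = (complex_of_real l *s ?w) $ i"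
      by (simp add: matrix_vector_mult_def)
  qed
  moreover have "?w \<noteq> 0"
    using assms(2) by (auto simp: vec_eq_iff)
  ultimately have "complex_of_real l \<in> complex_spectrum A"
    unfolding complex_spectrum_def by blast
  then have "cmod (complex_of_real l) \<le> spectral_radius A"
    unfolding spectral_radius_def by (rule cSUP_upper[OF _ bdd_above_cmod_complex_spectrum])
  then show ?thesis by simp
qed

text \<open>
  By compactness the Rayleigh quotient attains its maximum \<open>l\<close> on the unit sphere, say at \<open>v\<close>. The
  quadratic form \<open>f y = l * (y \<bullet> y) - y \<bullet> (A *v y)\<close> is nonnegative and vanishes at \<open>v\<close>, so its
  gradient vanishes there as well: \<open>v\<close> is an eigenvector for \<open>l\<close>, and \<open>l\<close> is at most the spectral
  radius.
\<close>

lemma quadratic_form_le_spectral_radius: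
  fixes A :: "real ^ 'n ^ 'n"
  assumes sym: "\<forall>i j. A $ i $ j = A $ j $ i"
  shows "x \<bullet> (A *v x) \<le> spectral_radius A * (x \<bullet> x)"
proof -
  have "continuous_on (sphere 0 1) (\<lambda>x. x \<bullet> (A *v x))"
    by (intro continuous_intros linear_continuous_on matrix_vector_mul_bounded_linear)
  moreover have "sphere (0::real^'n) 1 \<noteq> {}" "compact (sphere (0::real^'n) 1)"
    by auto
  ultimately obtain v where v: "norm v = 1"
    and max: "\<And>y. norm y = 1 \<Longrightarrow> y \<bullet> (A *v y) \<le> v \<bullet> (A *v v)"
    using continuous_attains_sup[of "sphere (0::real^'n) 1" "\<lambda>x. x \<bullet> (A *v x)"] by auto
  define l where "l = v \<bullet> (A *v v)"
  define f where "f y = l * (y \<bullet> y) - y \<bullet> (A *v y)" for y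
  have f_nonneg: "0 \<le> f y" for y
  proof (cases "y = 0")
    case False
    then have "(y /\<^sub>R norm y) \<bullet> (A *v (y /\<^sub>R norm y)) \<le> l"
      unfolding l_def by (intro max) simp
    then have "y \<bullet> (A *v y) \<le> l * (norm y * norm y)"
      using False by (simp add: matrix_vector_mult_scaleR field_simps)
    then show ?thesis
      by (simp add: f_def dot_square_norm power2_eq_square)
  qed (simp add: f_def)
  define r where "r = l *\<^sub>R v - A *v v"
  have "v \<bullet> v = 1"
    using v by (simp add: dot_square_norm)
  then have fv: "f v = 0"
    by (simp add: f_def l_def)
  have expand: "f (v - s *\<^sub>R r) = s\<^sup>2 * f r - 2 * s * (r \<bullet> r)" for s
  proof -
    have "f (v - s *\<^sub>R r) = f v + s\<^sup>2 * f r - 2 * s * (l * (r \<bullet> v) - r \<bullet> (A *v v))"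
      unfolding f_def using inner_matrix_vector_symmetric[OF sym, of v r]
      by (simp add: algebra_simps inner_commute power2_eq_square matrix_vector_mult_diff_distrib
        matrix_vector_mult_scaleR inner_diff)
    also have "l * (r \<bullet> v) - r \<bullet> (A *v v) = r \<bullet> r"
      by (simp add: r_def inner_diff_right)
    finally show ?thesis
      using fv by simp
  qed
  have "r \<bullet> r \<le> 0"
  proof (rule ccontr)
    assume "\<not> r \<bullet> r \<le> 0"
    \<comment> \<open>At this step length the linear term of the expansion outweighs the quadratic one; adding \<open>1\<close>
      keeps the denominator positive.\<close>
    moreover define s where "s = (r \<bullet> r) / (f r + 1)"
    ultimately have s: "0 < s" "s * (f r + 1) = r \<bullet> r"
      using f_nonneg[of r] by (auto intro!: divide_pos_pos)
    have "s * (2 * (r \<bullet> r) - s * f r) \<le> 0"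
      using f_nonneg[of "v - s *\<^sub>R r"] unfolding expand by (simp add: algebra_simps power2_eq_square)
    then have "2 * (r \<bullet> r) \<le> s * f r"
      using s(1) by (simp add: mult_le_0_iff)
    then show False
      using s \<open>\<not> r \<bullet> r \<le> 0\<close> by (simp add: algebra_simps)
  qed
  then have "r = 0"
    by (metis inner_ge_zero inner_eq_zero_iff order_antisym)
  then have "A *v v = l *\<^sub>R v" "v \<noteq> 0"
    using v by (auto simp: r_def)
  then have "l \<le> spectral_radius A"
    by (rule real_eigenvalue_le_spectral_radius)
  then have "l * (x \<bullet> x) \<le> spectral_radius A * (x \<bullet> x)"
    by (intro mult_right_mono) auto
  then show ?thesis
    using f_nonneg[of x] by (simp add: f_def)
qed

section \<open>Positive definite matrices with nonpositive off-diagonal entries\<close>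

text \<open>
  The symmetric matrices of this kind are the Stieltjes matrices; all of them are nonsingular
  M-matrices, and the two conditions below are the form in which this is used.
\<close>

definition positive_definite_Z_matrix :: "real ^ 'n ^ 'n \<Rightarrow> bool" where
  "positive_definite_Z_matrix A \<longleftrightarrow>
     (\<forall>x. x \<noteq> 0 \<longrightarrow> 0 < x \<bullet> (A *v x)) \<and> (\<forall>i j. i \<noteq> j \<longrightarrow> A $ i $ j \<le> 0)"

text \<open>
  Split \<open>e = p - m\<close> into its positive and negative parts. The alternative in the hypothesis makes
  every term of \<open>m \<bullet> (A *v e)\<close> nonnegative, while the signs of the off-diagonal entries make
  \<open>m \<bullet> (A *v p)\<close> nonpositive, as \<open>m\<close> and \<open>p\<close> have disjoint supports. Hence \<open>m \<bullet> (A *v m)\<close> is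
  nonpositive and \<open>m = 0\<close>. Allowing the alternative to depend on the coordinate is what makes the
  principle applicable to complementarity problems, where a different condition is known at each
  coordinate.
\<close>

lemma positive_definite_Z_minimum_principle:
  assumes A: "positive_definite_Z_matrix A"
    and e: "\<And>i. 0 \<le> e $ i \<or> 0 \<le> (A *v e) $ i"
  shows "0 \<le> e"
proof -
  define m where "m = (\<chi> i. max 0 (- e $ i))"
  define p where "p = (\<chi> i. max 0 (e $ i))"
  have e_eq: "e = p - m"
    by (auto simp: p_def m_def vec_eq_iff)
  have "m \<bullet> (A *v p) = (\<Sum>i\<in>UNIV. \<Sum>j\<in>UNIV. m $ i * (A $ i $ j * p $ j))"
    by (simp add: inner_vec_def matrix_vector_mult_def sum_distrib_left)
  also have "\<dots> \<le> 0"
  proof (intro sum_nonpos)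
    fix i j
    show "m $ i * (A $ i $ j * p $ j) \<le> 0"
    proof (cases "i = j")
      case True
      then show ?thesis by (simp add: m_def p_def max_def)
    next
      case False
      then have "A $ i $ j \<le> 0"
        using A by (simp add: positive_definite_Z_matrix_def)
      moreover have "0 \<le> m $ i" "0 \<le> p $ j"
        by (auto simp: m_def p_def)
      ultimately show ?thesis
        by (simp add: mult_nonneg_nonpos mult_nonpos_nonneg)
    qed
  qed
  finally have mp: "m \<bullet> (A *v p) \<le> 0" .
  have "0 \<le> m \<bullet> (A *v e)"
    unfolding inner_vec_def
  proof (intro sum_nonneg)
    fix i
    show "0 \<le> m $ i \<bullet> (A *v e) $ i"
      using e[of i] by (auto simp: m_def max_def mult_nonpos_nonneg)
  qed
  also have "\<dots> = m \<bullet> (A *v p) - m \<bullet> (A *v m)"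
    by (simp add: e_eq matrix_vector_mult_diff_distrib inner_diff_right)
  finally have "m \<bullet> (A *v m) \<le> 0"
    using mp by simp
  then have "m = 0"
    using A unfolding positive_definite_Z_matrix_def by (meson not_le)
  then have "max 0 (- e $ i) = 0" for i
    by (simp add: m_def vec_eq_iff)
  then have "0 \<le> e $ i" for i
    by (metis max.cobounded2 neg_le_0_iff_le)
  then show ?thesis
    by (simp add: less_eq_vec_def)
qed

lemma positive_definite_Z_nonneg:
  assumes "positive_definite_Z_matrix A" "0 \<le> A *v e"
  shows "0 \<le> e"
proof (rule positive_definite_Z_minimum_principle[OF assms(1)])
  show "0 \<le> e $ i \<or> 0 \<le> (A *v e) $ i" for i
    using assms(2) by (simp add: less_eq_vec_def)
qed

lemma positive_definite_Z_matrix_inv: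
  assumes "positive_definite_Z_matrix A"
  shows "A *v (matrix_inv A *v v) = v" "matrix_inv A *v (A *v v) = v"
proof -
  have "\<exists>B. B ** A = mat 1"
    unfolding matrix_left_invertible_ker
    using assms by (metis positive_definite_Z_matrix_def inner_zero_right less_irrefl)
  then obtain B where "A ** B = mat 1 \<and> B ** A = mat 1"
    by (metis matrix_left_right_inverse)
  then have "A ** matrix_inv A = mat 1 \<and> matrix_inv A ** A = mat 1"
    unfolding matrix_inv_def by (rule someI)
  then show "A *v (matrix_inv A *v v) = v" "matrix_inv A *v (A *v v) = v"
    by (simp_all add: matrix_vector_mul_assoc)
qed

lemma positive_definite_Z_matrix_inv_nonneg:
  assumes "positive_definite_Z_matrix A" "0 \<le> v"
  shows "0 \<le> matrix_inv A *v v"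
proof (rule positive_definite_Z_nonneg[OF assms(1)])
  show "0 \<le> A *v (matrix_inv A *v v)"
    using assms by (simp add: positive_definite_Z_matrix_inv)
qed

lemma matrix_vector_mult_uminus: "A *v (- v) = - (A *v v)" for A :: "real ^ 'n ^ 'm"
  using matrix_vector_mult_diff_distrib[of A 0 v] by simp

lemma positive_definite_Z_scaled_identity_minus:
  fixes G :: "real ^ 'n ^ 'n"
  assumes G: "adjacency_matrix G" and "0 \<le> a" "a * spectral_radius G < c"
  shows "positive_definite_Z_matrix (c *\<^sub>R mat 1 - a *\<^sub>R G)"
  unfolding positive_definite_Z_matrix_def
proof (intro conjI allI impI)
  fix x :: "real ^ 'n"
  assume "x \<noteq> 0"
  have "x \<bullet> (G *v x) \<le> spectral_radius G * (x \<bullet> x)"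
    using G by (intro quadratic_form_le_spectral_radius) (simp add: adjacency_matrix_def)
  then have "a * (x \<bullet> (G *v x)) \<le> a * (spectral_radius G * (x \<bullet> x))"
    using \<open>0 \<le> a\<close> by (rule mult_left_mono)
  also have "\<dots> < c * (x \<bullet> x)"
    using mult_strict_right_mono[OF assms(3), of "x \<bullet> x"] \<open>x \<noteq> 0\<close> by (simp add: mult.assoc)
  finally show "0 < x \<bullet> ((c *\<^sub>R mat 1 - a *\<^sub>R G) *v x)"
    by (simp add: matrix_vector_mult_diff_rdistrib inner_diff_right flip: scaleR_matrix_vector_assoc)
next
  fix i j :: 'n
  assume "i \<noteq> j"
  moreover have "0 \<le> G $ i $ j"
    using G unfolding adjacency_matrix_def by (metis insertE order_refl singletonD zero_le_one)
  ultimately show "(c *\<^sub>R mat 1 - a *\<^sub>R G) $ i $ j \<le> 0"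
    using \<open>0 \<le> a\<close> by (simp add: mat_def)
qed

section \<open>The linear complementarity problem\<close>

text \<open>
  The vector \<open>A *v y + q\<close> is the slack of the problem.
\<close>

definition lcp_solution :: "real ^ 'n ^ 'n \<Rightarrow> real ^ 'n \<Rightarrow> real ^ 'n \<Rightarrow> bool" where
  "lcp_solution A q y \<longleftrightarrow>
     0 \<le> y \<and> 0 \<le> A *v y + q \<and> (\<forall>i. y $ i = 0 \<or> (A *v y + q) $ i = 0)"

text \<open>
  At each coordinate either \<open>y'\<close> vanishes, so that \<open>y - y'\<close> is nonnegative, or the slack of \<open>y'\<close>
  vanishes, so that \<open>A *v (y - y')\<close> is nonnegative; the minimum principle combines the two. For
  \<open>q = q'\<close> this is uniqueness.
\<close>

lemma lcp_solution_antimono: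
  assumes A: "positive_definite_Z_matrix A"
    and y: "lcp_solution A q y" and y': "lcp_solution A q' y'" and "q \<le> q'"
  shows "y' \<le> y"
proof -
  have "0 \<le> y - y'"
  proof (rule positive_definite_Z_minimum_principle[OF A])
    fix i
    show "0 \<le> (y - y') $ i \<or> 0 \<le> (A *v (y - y')) $ i"
    proof (cases "y' $ i = 0")
      case True
      then show ?thesis using y by (simp add: lcp_solution_def less_eq_vec_def)
    next
      case False
      then have "(A *v y') $ i + q' $ i = 0"
        using y' by (auto simp: lcp_solution_def)
      moreover have "0 \<le> (A *v y) $ i + q $ i" "q $ i \<le> q' $ i"
        using y \<open>q \<le> q'\<close> by (auto simp: lcp_solution_def less_eq_vec_def)
      ultimately show ?thesis
        by (simp add: matrix_vector_mult_diff_distrib)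
    qed
  qed
  then show ?thesis by simp
qed

text \<open>
  Raising \<open>q\<close> lowers the solution, and lowering the other coordinates can only raise the slack of a
  coordinate that stays at zero. At a coordinate where the first solution is positive, its slack
  is zero already.
\<close>

lemma lcp_solution_slack_mono:
  assumes A: "positive_definite_Z_matrix A"
    and y: "lcp_solution A q y" and y': "lcp_solution A q' y'" and "q \<le> q'"
  shows "A *v y + q \<le> A *v y' + q'"
  unfolding less_eq_vec_def
proof
  fix i
  have le: "y' $ j \<le> y $ j" for j
    using lcp_solution_antimono[OF assms] by (simp add: less_eq_vec_def)
  show "(A *v y + q) $ i \<le> (A *v y' + q') $ i"
  proof (cases "y $ i = 0")
    case True
    moreover have "0 \<le> y' $ i"
      using y' by (simp add: lcp_solution_def less_eq_vec_def)
    ultimately have "y' $ i = y $ i"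
      using le[of i] by simp
    have "A $ i $ j * y $ j \<le> A $ i $ j * y' $ j" for j
    proof (cases "j = i")
      case False
      then have "A $ i $ j \<le> 0"
        using A by (simp add: positive_definite_Z_matrix_def)
      then show ?thesis using le by (intro mult_left_mono_neg)
    qed (simp add: \<open>y' $ i = y $ i\<close>)
    then have "(A *v y) $ i \<le> (A *v y') $ i"
      by (auto simp: matrix_vector_mult_def intro: sum_mono)
    then show ?thesis
      using \<open>q \<le> q'\<close> by (auto simp: less_eq_vec_def intro: add_mono)
  next
    case False
    then have "(A *v y + q) $ i = 0"
      using y by (simp only: lcp_solution_def) blast
    moreover have "0 \<le> (A *v y' + q') $ i"
      using y' by (simp only: lcp_solution_def less_eq_vec_def) simp
    ultimately show ?thesis by simp
  qed
qed

text \<open>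
  Among the nonnegative vectors below \<open>u\<close> with nonnegative slack, one of least coordinate sum is a
  solution: if a coordinate and its slack were both positive, that coordinate could be lowered a
  little, which only raises the other slacks.
\<close>

lemma lcp_solution_exists:
  assumes A: "positive_definite_Z_matrix A"
    and u: "0 \<le> u" "0 \<le> A *v u + q"
  shows "\<exists>y. lcp_solution A q y"
proof -
  define F where "F = {y. 0 \<le> y \<and> y \<le> u \<and> 0 \<le> A *v y + q}"
  have F_eq: "F = cbox 0 u \<inter> (\<Inter>i. {y. 0 \<le> (A *v y + q) $ i})"
    by (auto simp: F_def less_eq_vec_def mem_box_cart)
  have "closed {y. 0 \<le> (A *v y + q) $ i}" for i
    by (intro closed_Collect_le continuous_intros linear_continuous_on
      matrix_vector_mul_bounded_linear)
  then have "compact F"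
    unfolding F_eq by (intro compact_Int_closed) auto
  moreover have "u \<in> F"
    using u by (simp add: F_def)
  moreover have "continuous_on F (\<lambda>y. \<Sum>i\<in>UNIV. y $ i)"
    by (intro continuous_intros)
  ultimately obtain y where "y \<in> F" and min: "\<And>z. z \<in> F \<Longrightarrow> (\<Sum>i\<in>UNIV. y $ i) \<le> (\<Sum>i\<in>UNIV. z $ i)"
    using continuous_attains_inf[of F "\<lambda>y. \<Sum>i\<in>UNIV. y $ i"] by blast
  then have y: "0 \<le> y" "y \<le> u" "0 \<le> A *v y + q"
    by (auto simp: F_def)
  have "y $ i = 0 \<or> (A *v y + q) $ i = 0" for i
  proof (rule ccontr)
    assume "\<not> ?thesis"
    then have pos: "0 < y $ i" "0 < (A *v y + q) $ i"
      using y by (auto simp: less_eq_vec_def less_le simp del: vector_add_component)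
    define a where "a = A $ i $ i"
    define t where "t = min (y $ i) ((A *v y + q) $ i / (\<bar>a\<bar> + 1))"
    have t: "0 < t" "t \<le> y $ i"
      using pos by (auto simp: t_def)
    have "t * (\<bar>a\<bar> + 1) \<le> (A *v y + q) $ i"
      using min.cobounded2[of "y $ i" "(A *v y + q) $ i / (\<bar>a\<bar> + 1)"]
      unfolding t_def[symmetric] by (simp add: pos_le_divide_eq)
    moreover have "t * a \<le> t * (\<bar>a\<bar> + 1)"
      using t by (intro mult_left_mono) auto
    ultimately have ta: "t * a \<le> (A *v y + q) $ i"
      by linarith
    have Ay: "A *v (y - t *\<^sub>R axis i 1) + q = A *v y + q - t *\<^sub>R column i A"
      by (simp add: matrix_vector_mult_diff_distrib matrix_vector_mult_scaleR
        matrix_vector_mult_basis)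
    have "0 \<le> (A *v y + q - t *\<^sub>R column i A) $ j" for j
    proof (cases "j = i")
      case True
      then show ?thesis using ta by (simp add: column_def a_def)
    next
      case False
      then have "A $ j $ i \<le> 0"
        using A by (simp add: positive_definite_Z_matrix_def)
      then have "t * A $ j $ i \<le> 0"
        using t by (simp add: mult_nonneg_nonpos)
      moreover have "0 \<le> (A *v y + q) $ j"
        using y(3) by (simp only: less_eq_vec_def) simp
      ultimately show ?thesis by (simp add: column_def)
    qed
    then have "0 \<le> A *v (y - t *\<^sub>R axis i 1) + q"
      unfolding Ay by (simp only: less_eq_vec_def) simp
    moreover have "0 \<le> y - t *\<^sub>R axis i 1" "y - t *\<^sub>R axis i 1 \<le> u"
      using y t by (auto simp: less_eq_vec_def axis_def algebra_simps intro: order_trans)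
    ultimately have "y - t *\<^sub>R axis i 1 \<in> F"
      by (simp add: F_def)
    then have "(\<Sum>j\<in>UNIV. y $ j) \<le> (\<Sum>j\<in>UNIV. y $ j) - t * (\<Sum>j\<in>UNIV. axis i 1 $ j)"
      using min[of "y - t *\<^sub>R axis i 1"] by (simp add: sum_subtractf sum_distrib_left)
    moreover have "(\<Sum>j\<in>UNIV. axis i (1::real) $ j) = 1"
      by (simp add: axis_def)
    ultimately show False
      using t by simp
  qed
  then show ?thesis
    using y by (auto simp: lcp_solution_def)
qed

section \<open>Best responses\<close>

text \<open>
  The hypothesis is tested at the unconstrained maximiser \<open>t = g\<close>, which gives \<open>g = 0\<close>. If that
  point lies below the half-line, then the end point \<open>t = - x\<close> already beats \<open>t = 0\<close> unless the
  two coincide.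
\<close>

lemma quadratic_max_on_half_line:
  fixes g x :: real
  assumes "0 \<le> x" and max: "\<And>t. - x \<le> t \<Longrightarrow> t * g - t\<^sup>2 / 2 \<le> 0"
  shows "g \<le> 0 \<and> (x = 0 \<or> g = 0)"
proof (cases "- x \<le> g")
  case True
  then have "g = 0"
    using max[of g] by (auto simp: power2_eq_square) (smt (verit) not_real_square_gt_zero)
  then show ?thesis by simp
next
  case False
  have "0 \<le> x * (2 * g + x)"
    using max[of "- x"] by (simp add: power2_eq_square algebra_simps)
  moreover have "2 * g + x < 0"
    using False \<open>0 \<le> x\<close> by linarith
  ultimately have "x = 0"
    using \<open>0 \<le> x\<close> by (metis mult_pos_neg not_le order_le_less)
  then show ?thesis using False by simp
qed

text \<open>
  The first order conditions of an agent who exerts effort in the first activity. They are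
  necessary by varying one coordinate at a time, and sufficient because the quadratic form
  \<open>(h\<^sup>2 + k\<^sup>2) / 2 + \<beta> * h * k\<close> of a joint deviation is nonnegative for \<open>0 < \<beta> < 1\<close>.
\<close>

lemma two_activity_best_response_iff:
  fixes f :: "real \<Rightarrow> real \<Rightarrow> real"
  assumes f: "\<And>a c. f a c = r * a + s * c - a\<^sup>2 / 2 - c\<^sup>2 / 2 - \<beta> * a * c"
    and "0 < \<beta>" "\<beta> < 1" "0 < x" "0 \<le> y"
  shows "(\<forall>a c. 0 \<le> a \<longrightarrow> 0 \<le> c \<longrightarrow> f a c \<le> f x y) \<longleftrightarrow>
    r = x + \<beta> * y \<and> s \<le> y + \<beta> * x \<and> (y = 0 \<or> s = y + \<beta> * x)"
proof
  assume best: "\<forall>a c. 0 \<le> a \<longrightarrow> 0 \<le> c \<longrightarrow> f a c \<le> f x y"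
  have "t * (r - x - \<beta> * y) - t\<^sup>2 / 2 \<le> 0" if "- x \<le> t" for t
    using best[rule_format, of "x + t" y] that \<open>0 \<le> y\<close> unfolding f
    by (simp add: power2_eq_square field_simps)
  from quadratic_max_on_half_line[OF less_imp_le[OF \<open>0 < x\<close>] this] have 1: "r = x + \<beta> * y"
    using \<open>0 < x\<close> by auto
  have "t * (s - y - \<beta> * x) - t\<^sup>2 / 2 \<le> 0" if "- y \<le> t" for t
    using best[rule_format, of x "y + t"] that \<open>0 < x\<close> unfolding f
    by (simp add: power2_eq_square field_simps)
  from quadratic_max_on_half_line[OF \<open>0 \<le> y\<close> this] 1
  show "r = x + \<beta> * y \<and> s \<le> y + \<beta> * x \<and> (y = 0 \<or> s = y + \<beta> * x)"
    by auto
next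
  assume kkt: "r = x + \<beta> * y \<and> s \<le> y + \<beta> * x \<and> (y = 0 \<or> s = y + \<beta> * x)"
  show "\<forall>a c. 0 \<le> a \<longrightarrow> 0 \<le> c \<longrightarrow> f a c \<le> f x y"
  proof (intro allI impI)
    fix a c :: real
    assume "0 \<le> a" "0 \<le> c"
    define Q where "Q = (1 - \<beta>) * ((a - x)\<^sup>2 + (c - y)\<^sup>2) + \<beta> * ((a - x) + (c - y))\<^sup>2"
    have "(c - y) * (s - y - \<beta> * x) \<le> 0"
      using kkt \<open>0 \<le> c\<close> by (auto simp: mult_nonneg_nonpos)
    moreover have "f a c - f x y = (a - x) * (r - x - \<beta> * y) + (c - y) * (s - y - \<beta> * x) - Q / 2"
      unfolding f Q_def by (simp add: power2_eq_square field_simps)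
    moreover have "0 \<le> Q"
      unfolding Q_def using assms by simp
    moreover have "(a - x) * (r - x - \<beta> * y) = 0"
      using kkt by simp
    ultimately show "f a c \<le> f x y"
      by linarith
  qed
qed

text \<open>
  As an agent is not her own neighbour, her deviation leaves the terms \<open>G *v x\<close> and \<open>G *v y\<close>
  that she faces unchanged, and her utility is a concave quadratic function of her two efforts.
\<close>

lemma utility_deviate:
  fixes G :: "real ^ 'n ^ 'n"
  assumes "G $ i $ i = 0"
  shows "utility G \<beta> \<delta> \<mu> (deviate (x, y) i a c) (pA, pB) i =
    (pA $ i + \<delta> * (G *v x) $ i + \<mu> * (G *v y) $ i) * a
    + (pB $ i + \<delta> * (G *v y) $ i + \<mu> * (G *v x) $ i) * c
    - a\<^sup>2 / 2 - c\<^sup>2 / 2 - \<beta> * a * c"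
proof -
  have *: "G $ i $ j * (if j = i then d else v $ j) = G $ i $ j * v $ j" for d v j
    using assms by simp
  have sum: "(\<Sum>j\<in>UNIV. G $ i $ j * (a * (if j = i then d else v $ j) + c * (if j = i then e else w $ j)))
     = a * (G *v v) $ i + c * (G *v w) $ i" for d e v w
  proof -
    have "(\<Sum>j\<in>UNIV. G $ i $ j * (a * (if j = i then d else v $ j) + c * (if j = i then e else w $ j)))
       = (\<Sum>j\<in>UNIV. a * (G $ i $ j * (if j = i then d else v $ j))
           + c * (G $ i $ j * (if j = i then e else w $ j)))"
      by (intro sum.cong refl) (simp add: algebra_simps)
    also have "\<dots> = a * (G *v v) $ i + c * (G *v w) $ i"
      unfolding * by (simp add: sum.distrib sum_distrib_left matrix_vector_mult_def)
    finally show ?thesis .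
  qed
  show ?thesis
    unfolding deviate.simps utility.simps by (simp add: sum) (simp add: algebra_simps)
qed

lemma deviate_self: "deviate (x, y) i (x $ i) (y $ i) = (x, y)"
  by (simp add: vec_eq_iff)

section \<open>Reduction of the game to a complementarity problem\<close>

locale network_game =
  fixes G :: "real ^ 'n ^ 'n" and \<beta> \<delta> \<mu> :: real
  assumes adjacency: "adjacency_matrix G"
    and params: "0 < \<beta>" "\<beta> < 1" "0 < \<delta>" "0 < \<mu>" "\<mu> < \<beta> * \<delta>"
    and spectral: "max (\<bar>\<delta> + \<mu>\<bar> / (1 + \<beta>)) (\<bar>\<delta> - \<mu>\<bar> / (1 - \<beta>)) * spectral_radius G < 1"
begin

text \<open>
  With efforts \<open>(x, y)\<close>, the interior first order conditions are \<open>own *v x + cross *v y = pA\<close> and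
  \<open>cross *v x + own *v y = pB\<close>. Their sum and difference involve \<open>own + cross\<close> and \<open>own - cross\<close>,
  the inverses of \<open>M_plus\<close> and \<open>M_minus\<close>.
\<close>

definition own where "own = mat 1 - \<delta> *\<^sub>R G"
definition cross where "cross = \<beta> *\<^sub>R mat 1 - \<mu> *\<^sub>R G"
definition own_inverse where "own_inverse = matrix_inv own"

text \<open>
  This is \<open>cross ** own_inverse\<close>, written so that its nonnegativity is visible: \<open>cross\<close> equals
  \<open>(\<mu> / \<delta>) *\<^sub>R own + (\<beta> - \<mu> / \<delta>) *\<^sub>R mat 1\<close>, and both coefficients are positive as \<open>\<mu> < \<beta> * \<delta>\<close>.
\<close>

definition crowding where "crowding = (\<mu> / \<delta>) *\<^sub>R mat 1 + (\<beta> - \<mu> / \<delta>) *\<^sub>R own_inverse"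

text \<open>
  This is the Schur complement \<open>own - cross ** own_inverse ** cross\<close>, the matrix of the game after
  the efforts in activity A have been eliminated. The form below shows the signs of the
  off-diagonal entries.
\<close>

definition reduced where
  "reduced = (1 - (\<mu> / \<delta>)\<^sup>2) *\<^sub>R own - (2 * (\<mu> / \<delta>) * (\<beta> - \<mu> / \<delta>)) *\<^sub>R mat 1
       - (\<beta> - \<mu> / \<delta>)\<^sup>2 *\<^sub>R own_inverse"

lemma mu_less_delta: "\<mu> < \<delta>"
  using params mult_strict_right_mono[of \<beta> 1 \<delta>] by linarith

lemma ratio: "0 < \<mu> / \<delta>" "\<mu> / \<delta> < \<beta>" "\<mu> / \<delta> < 1"
  using params mu_less_delta by (auto simp: divide_less_eq)

text \<open>
  Clearing denominators in the spectral condition. The sign of the spectral radius is split on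
  because the condition is trivial for a negative one.
\<close>

lemma spectral_plus: "(\<delta> + \<mu>) * spectral_radius G < 1 + \<beta>"
  and spectral_minus: "(\<delta> - \<mu>) * spectral_radius G < 1 - \<beta>"
proof -
  let ?r = "spectral_radius G"
  have "(\<delta> + \<mu>) * ?r < 1 + \<beta> \<and> (\<delta> - \<mu>) * ?r < 1 - \<beta>"
  proof (cases "0 \<le> ?r")
    case True
    have "(\<delta> + \<mu>) / (1 + \<beta>) * ?r \<le> max (\<bar>\<delta> + \<mu>\<bar> / (1 + \<beta>)) (\<bar>\<delta> - \<mu>\<bar> / (1 - \<beta>)) * ?r"
      "(\<delta> - \<mu>) / (1 - \<beta>) * ?r \<le> max (\<bar>\<delta> + \<mu>\<bar> / (1 + \<beta>)) (\<bar>\<delta> - \<mu>\<bar> / (1 - \<beta>)) * ?r"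
      using params mu_less_delta True by (intro mult_right_mono; simp)+
    then have "(\<delta> + \<mu>) / (1 + \<beta>) * ?r < 1" "(\<delta> - \<mu>) / (1 - \<beta>) * ?r < 1"
      using spectral by linarith+
    then show ?thesis
      using params by (simp add: field_simps)
  next
    case False
    then have "(\<delta> + \<mu>) * ?r < 0" "(\<delta> - \<mu>) * ?r < 0"
      using params mu_less_delta by (auto intro: mult_pos_neg)
    then show ?thesis
      using params by linarith
  qed
  then show "(\<delta> + \<mu>) * ?r < 1 + \<beta>" "(\<delta> - \<mu>) * ?r < 1 - \<beta>"
    by auto
qed

lemma plus_pd: "positive_definite_Z_matrix ((1 + \<beta>) *\<^sub>R mat 1 - (\<delta> + \<mu>) *\<^sub>R G)"
  using params spectral_plus
  by (intro positive_definite_Z_scaled_identity_minus adjacency) auto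

lemma minus_pd: "positive_definite_Z_matrix ((1 - \<beta>) *\<^sub>R mat 1 - (\<delta> - \<mu>) *\<^sub>R G)"
  using mu_less_delta spectral_minus
  by (intro positive_definite_Z_scaled_identity_minus adjacency) auto

lemma own_pd: "positive_definite_Z_matrix own"
proof -
  have "\<delta> * spectral_radius G < 1"
    using spectral_plus spectral_minus by (simp add: algebra_simps)
  then have "positive_definite_Z_matrix (1 *\<^sub>R mat 1 - \<delta> *\<^sub>R G)"
    using params by (intro positive_definite_Z_scaled_identity_minus adjacency) auto
  then show ?thesis by (simp add: own_def)
qed

lemma own_apply: "own *v v = v - \<delta> *\<^sub>R (G *v v)"
  by (simp add: own_def matrix_vector_mult_diff_rdistrib scaleR_matrix_vector_assoc)

lemma cross_apply: "cross *v v = \<beta> *\<^sub>R v - \<mu> *\<^sub>R (G *v v)"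
  by (simp add: cross_def matrix_vector_mult_diff_rdistrib flip: scaleR_matrix_vector_assoc)

lemma plus_apply: "((1 + \<beta>) *\<^sub>R mat 1 - (\<delta> + \<mu>) *\<^sub>R G) *v v = own *v v + cross *v v"
  by (simp add: own_apply cross_apply matrix_vector_mult_diff_rdistrib algebra_simps
    flip: scaleR_matrix_vector_assoc)

lemma minus_apply: "((1 - \<beta>) *\<^sub>R mat 1 - (\<delta> - \<mu>) *\<^sub>R G) *v v = own *v v - cross *v v"
  by (simp add: own_apply cross_apply matrix_vector_mult_diff_rdistrib algebra_simps
    flip: scaleR_matrix_vector_assoc)

lemma cross_eq: "cross *v v = (\<mu> / \<delta>) *\<^sub>R (own *v v) + (\<beta> - \<mu> / \<delta>) *\<^sub>R v"
  using params by (simp add: own_apply cross_apply algebra_simps)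

lemma crowding_apply: "crowding *v v = (\<mu> / \<delta>) *\<^sub>R v + (\<beta> - \<mu> / \<delta>) *\<^sub>R (own_inverse *v v)"
  by (simp add: crowding_def matrix_vector_mult_add_rdistrib flip: scaleR_matrix_vector_assoc)

lemma reduced_apply:
  "reduced *v v = (1 - (\<mu> / \<delta>)\<^sup>2) *\<^sub>R (own *v v) - (2 * (\<mu> / \<delta>) * (\<beta> - \<mu> / \<delta>)) *\<^sub>R v
       - (\<beta> - \<mu> / \<delta>)\<^sup>2 *\<^sub>R (own_inverse *v v)"
  by (simp add: reduced_def matrix_vector_mult_diff_rdistrib flip: scaleR_matrix_vector_assoc)

lemma own_own_inverse [simp]: "own *v (own_inverse *v v) = v"
  and own_inverse_own [simp]: "own_inverse *v (own *v v) = v"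
  unfolding own_inverse_def by (rule positive_definite_Z_matrix_inv[OF own_pd])+

lemma own_inverse_nonneg: "0 \<le> v \<Longrightarrow> 0 \<le> own_inverse *v v"
  unfolding own_inverse_def by (rule positive_definite_Z_matrix_inv_nonneg[OF own_pd])

lemma crowding_nonneg:
  assumes "0 \<le> v"
  shows "0 \<le> crowding *v v"
proof -
  have "0 \<le> v $ i" "0 \<le> (own_inverse *v v) $ i" for i
    using assms own_inverse_nonneg[OF assms] by (auto simp: less_eq_vec_def)
  then show ?thesis
    unfolding crowding_apply less_eq_vec_def using ratio
    by (auto simp only: vector_add_component vector_scaleR_component real_scaleR_def zero_index
      intro!: add_nonneg_nonneg mult_nonneg_nonneg)
qed

lemma own_crowding: "own *v (crowding *v v) = cross *v v"
  by (simp add: crowding_apply cross_eq matrix_vector_right_distrib matrix_vector_mult_scaleR)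

lemma cross_own_inverse: "cross *v (own_inverse *v v) = crowding *v v"
  by (simp add: cross_eq crowding_apply)

lemma reduced_eq: "reduced *v v = own *v v - cross *v (crowding *v v)"
proof -
  define k g where "k = \<mu> / \<delta>" and "g = \<beta> - k"
  have "cross *v (crowding *v v) = k *\<^sub>R (cross *v v) + g *\<^sub>R (crowding *v v)"
    by (simp add: crowding_apply[of v] cross_own_inverse matrix_vector_right_distrib
      matrix_vector_mult_scaleR k_def g_def)
  also have "\<dots> = k *\<^sub>R (k *\<^sub>R (own *v v) + g *\<^sub>R v) + g *\<^sub>R (k *\<^sub>R v + g *\<^sub>R (own_inverse *v v))"
    unfolding cross_eq crowding_apply k_def g_def ..
  finally show ?thesis
    unfolding reduced_apply k_def[symmetric] g_def[symmetric]
    by (simp add: vec_eq_iff power2_eq_square algebra_simps)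
qed

text \<open>
  Off the diagonal, \<open>own\<close> is nonpositive and \<open>own_inverse\<close> nonnegative. For definiteness,
  complete \<open>y\<close> by the \<open>x\<close> that solves \<open>own *v x + cross *v y = 0\<close>: the form of the Schur
  complement at \<open>y\<close> is then the form of the full two-activity game at \<open>(x, y)\<close>, which is half the
  sum of those of \<open>own + cross\<close> at \<open>x + y\<close> and of \<open>own - cross\<close> at \<open>x - y\<close>.
\<close>

lemma reduced_pd: "positive_definite_Z_matrix reduced"
  unfolding positive_definite_Z_matrix_def
proof (intro conjI allI impI)
  fix y :: "real ^ 'n"
  assume "y \<noteq> 0"
  define x where "x = - (crowding *v y)"
  have Tx: "own *v x + cross *v y = 0"
    unfolding x_def by (simp add: own_crowding matrix_vector_mult_uminus)
  have Sy: "reduced *v y = own *v y + cross *v x"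
    unfolding x_def by (simp add: reduced_eq matrix_vector_mult_uminus)
  let ?P = "(1 + \<beta>) *\<^sub>R mat 1 - (\<delta> + \<mu>) *\<^sub>R G" and ?M = "(1 - \<beta>) *\<^sub>R mat 1 - (\<delta> - \<mu>) *\<^sub>R G"
  have "2 * (y \<bullet> (reduced *v y)) = 2 * (y \<bullet> (own *v y + cross *v x)) + 2 * (x \<bullet> (own *v x + cross *v y))"
    by (simp add: Sy Tx)
  also have "\<dots> = (x + y) \<bullet> (?P *v (x + y)) + (x - y) \<bullet> (?M *v (x - y))"
    unfolding plus_apply minus_apply
    by (simp add: matrix_vector_right_distrib matrix_vector_mult_diff_distrib
      inner_add_left inner_add_right inner_diff_left inner_diff_right)
  finally have eq: "2 * (y \<bullet> (reduced *v y)) = (x + y) \<bullet> (?P *v (x + y)) + (x - y) \<bullet> (?M *v (x - y))" .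
  have pos: "0 < z \<bullet> (?P *v z)" "0 < z \<bullet> (?M *v z)" if "z \<noteq> 0" for z
    using plus_pd minus_pd that by (simp_all add: positive_definite_Z_matrix_def)
  then have nonneg: "0 \<le> z \<bullet> (?P *v z)" "0 \<le> z \<bullet> (?M *v z)" for z
    by (metis inner_zero_left order_le_less)+
  have "x + y \<noteq> 0 \<or> x - y \<noteq> 0"
  proof (rule ccontr)
    assume "\<not> ?thesis"
    moreover have "y = (1 / 2) *\<^sub>R ((x + y) - (x - y))"
      by (simp add: vec_eq_iff)
    ultimately show False
      using \<open>y \<noteq> 0\<close> by (metis diff_self right_minus_eq scaleR_zero_right)
  qed
  then have "0 < (x + y) \<bullet> (?P *v (x + y)) + (x - y) \<bullet> (?M *v (x - y))"
  proof
    assume "x + y \<noteq> 0"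
    then show ?thesis by (rule add_pos_nonneg[OF pos(1) nonneg(2)])
  next
    assume "x - y \<noteq> 0"
    then show ?thesis by (rule add_nonneg_pos[OF nonneg(1) pos(2)])
  qed
  then show "0 < y \<bullet> (reduced *v y)"
    unfolding eq[symmetric] by simp
next
  fix i j :: 'n
  assume "i \<noteq> j"
  have "0 \<le> (axis j 1 :: real ^ 'n)"
    by (simp add: less_eq_vec_def axis_def)
  then have "0 \<le> own_inverse *v axis j 1"
    by (rule own_inverse_nonneg)
  then have "0 \<le> own_inverse $ i $ j"
    by (simp add: less_eq_vec_def matrix_vector_mult_basis column_def)
  moreover have "own $ i $ j \<le> 0"
    using own_pd \<open>i \<noteq> j\<close> by (simp add: positive_definite_Z_matrix_def)
  moreover have "(\<mu> / \<delta>)\<^sup>2 \<le> 1"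
    using ratio by (simp only: power_le_one_iff abs_square_le_1)
  ultimately have "(1 - (\<mu> / \<delta>)\<^sup>2) * own $ i $ j \<le> 0" "0 \<le> (\<beta> - \<mu> / \<delta>)\<^sup>2 * own_inverse $ i $ j"
    by (auto simp: mult_nonneg_nonpos)
  then show "reduced $ i $ j \<le> 0"
    using \<open>i \<noteq> j\<close> by (simp add: reduced_def mat_def)
qed

lemma equilibrium_iff_first_order:
  "equilibrium G \<beta> \<delta> \<mu> (pA, pB) (x, y) \<longleftrightarrow>
     (\<forall>i. 0 < x $ i) \<and> 0 \<le> y \<and> own *v x + cross *v y = pA \<and> pB \<le> own *v y + cross *v x \<and>
     (\<forall>i. y $ i = 0 \<or> (own *v y + cross *v x) $ i = pB $ i)"
proof (cases "(\<forall>i. 0 < x $ i) \<and> 0 \<le> y")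
  case False
  then show ?thesis
    by (auto simp: equilibrium_def nash_def)
next
  case True
  then have x: "\<And>i. 0 < x $ i" and y: "\<And>i. 0 \<le> y $ i"
    by (auto simp: less_eq_vec_def)
  define r where "r i = pA $ i + \<delta> * (G *v x) $ i + \<mu> * (G *v y) $ i" for i
  define s where "s i = pB $ i + \<delta> * (G *v y) $ i + \<mu> * (G *v x) $ i" for i
  define f where "f i a c = r i * a + s i * c - a\<^sup>2 / 2 - c\<^sup>2 / 2 - \<beta> * a * c" for i and a c :: real
  have dev: "utility G \<beta> \<delta> \<mu> (deviate (x, y) i a c) (pA, pB) i = f i a c" for i a c
    unfolding f_def r_def s_def using adjacency
    by (intro utility_deviate) (simp add: adjacency_matrix_def)
  have self: "utility G \<beta> \<delta> \<mu> (x, y) (pA, pB) i = f i (x $ i) (y $ i)" for i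
    using dev[of i "x $ i" "y $ i"] unfolding deviate_self .
  have best: "(\<forall>a c. 0 \<le> a \<longrightarrow> 0 \<le> c \<longrightarrow> f i a c \<le> f i (x $ i) (y $ i)) \<longleftrightarrow>
      r i = x $ i + \<beta> * y $ i \<and> s i \<le> y $ i + \<beta> * x $ i \<and>
      (y $ i = 0 \<or> s i = y $ i + \<beta> * x $ i)" for i
    by (rule two_activity_best_response_iff) (use params x y in \<open>auto simp: f_def\<close>)
  have "equilibrium G \<beta> \<delta> \<mu> (pA, pB) (x, y) \<longleftrightarrow>
      (\<forall>i a c. 0 \<le> a \<longrightarrow> 0 \<le> c \<longrightarrow> f i a c \<le> f i (x $ i) (y $ i))"
    using x True unfolding equilibrium_def nash_def dev self
    by (auto simp: less_eq_vec_def less_imp_le)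
  also have "\<dots> \<longleftrightarrow> (\<forall>i. r i = x $ i + \<beta> * y $ i \<and> s i \<le> y $ i + \<beta> * x $ i \<and>
      (y $ i = 0 \<or> s i = y $ i + \<beta> * x $ i))"
    unfolding best[symmetric] by blast
  also have "\<dots> \<longleftrightarrow> (\<forall>i. (own *v x + cross *v y) $ i = pA $ i \<and> pB $ i \<le> (own *v y + cross *v x) $ i \<and>
      (y $ i = 0 \<or> (own *v y + cross *v x) $ i = pB $ i))"
    by (intro all_cong1) (auto simp: r_def s_def own_apply cross_apply algebra_simps)
  finally show ?thesis
    using True unfolding less_eq_vec_def[of pB] vec_eq_iff by blast
qed

text \<open>
  When all efforts in activity A are positive, their first order conditions are linear equations
  and determine \<open>x\<close> from \<open>y\<close>. What remains for \<open>y\<close> is a linear complementarity problem, whose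
  slack is the amount by which the marginal cost of activity B exceeds its marginal benefit.
\<close>

lemma equilibrium_iff_lcp:
  "equilibrium G \<beta> \<delta> \<mu> (pA, pB) (x, y) \<longleftrightarrow>
     (\<forall>i. 0 < x $ i) \<and> x = own_inverse *v pA - crowding *v y \<and>
     lcp_solution reduced (crowding *v pA - pB) y"
proof -
  have solve: "own *v x + cross *v y = pA \<longleftrightarrow> x = own_inverse *v pA - crowding *v y"
  proof
    assume "own *v x + cross *v y = pA"
    then have "own *v (x + crowding *v y) = pA"
      by (simp add: matrix_vector_right_distrib own_crowding)
    then show "x = own_inverse *v pA - crowding *v y"
      using own_inverse_own[of "x + crowding *v y"] by (simp add: algebra_simps)
  next
    assume "x = own_inverse *v pA - crowding *v y"
    then show "own *v x + cross *v y = pA"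
      by (simp add: matrix_vector_mult_diff_distrib own_crowding)
  qed
  have slack: "reduced *v y + (crowding *v pA - pB) = own *v y + cross *v x - pB"
    if "x = own_inverse *v pA - crowding *v y"
    unfolding that by (simp add: matrix_vector_mult_diff_distrib cross_own_inverse reduced_eq)
  show ?thesis
  proof (cases "x = own_inverse *v pA - crowding *v y")
    case True
    then show ?thesis
      unfolding equilibrium_iff_first_order solve lcp_solution_def slack[OF True]
      by simp
  qed (simp add: equilibrium_iff_first_order solve)
qed

section \<open>Comparative statics of equilibrium efforts and utilities\<close>

lemma lcp_vector_mono:
  assumes "pA \<le> pA'" "pB' \<le> pB"
  shows "crowding *v pA - pB \<le> crowding *v pA' - pB'"
proof -
  have "0 \<le> crowding *v (pA' - pA)"
    using assms by (intro crowding_nonneg) simp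
  then show ?thesis
    using assms(2) by (intro diff_mono) (simp_all add: matrix_vector_mult_diff_distrib)
qed

lemma sustainable_effort_mono:
  assumes "pA \<le> pA'" "y' \<le> y"
  shows "own_inverse *v pA - crowding *v y \<le> own_inverse *v pA' - crowding *v y'"
proof -
  have "0 \<le> own_inverse *v (pA' - pA)" "0 \<le> crowding *v (y - y')"
    using assms by (auto intro: own_inverse_nonneg crowding_nonneg)
  then show ?thesis
    by (intro diff_mono) (simp_all add: matrix_vector_mult_diff_distrib)
qed

text \<open>
  Both price changes raise the vector \<open>crowding *v pA - pB\<close> of the complementarity problem, so
  activity B shrinks and its slack grows; activity A gains from its own price and from the decline
  of activity B.
\<close>

lemma equilibrium_mono:
  assumes eq: "equilibrium G \<beta> \<delta> \<mu> (pA, pB) (x, y)"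
    and eq': "equilibrium G \<beta> \<delta> \<mu> (pA', pB') (x', y')"
    and le: "pA \<le> pA'" "pB' \<le> pB"
  shows "y' \<le> y" and "x \<le> x'"
    and "own *v y + cross *v x - pB \<le> own *v y' + cross *v x' - pB'"
proof -
  have lcp: "lcp_solution reduced (crowding *v pA - pB) y"
    "lcp_solution reduced (crowding *v pA' - pB') y'"
    and x: "x = own_inverse *v pA - crowding *v y" "x' = own_inverse *v pA' - crowding *v y'"
    using eq eq' by (auto simp: equilibrium_iff_lcp)
  show y: "y' \<le> y"
    by (rule lcp_solution_antimono[OF reduced_pd lcp lcp_vector_mono[OF le]])
  show "x \<le> x'"
    unfolding x by (rule sustainable_effort_mono[OF le(1) y])
  show "own *v y + cross *v x - pB \<le> own *v y' + cross *v x' - pB'"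
    using lcp_solution_slack_mono[OF reduced_pd lcp lcp_vector_mono[OF le]]
    unfolding x by (simp add: matrix_vector_mult_diff_distrib cross_own_inverse reduced_eq algebra_simps)
qed

lemma equilibrium_unique:
  assumes "equilibrium G \<beta> \<delta> \<mu> p z" "equilibrium G \<beta> \<delta> \<mu> p z'"
  shows "z = z'"
proof (cases p, cases z, cases z')
  fix pA pB x y x' y'
  assume [simp]: "p = (pA, pB)" "z = (x, y)" "z' = (x', y')"
  show "z = z'"
    using equilibrium_mono[of pA pB x y pA pB x' y'] equilibrium_mono[of pA pB x' y' pA pB x y] assms
    by (auto intro: antisym)
qed

text \<open>
  The old efforts in activity B remain admissible for the new complementarity problem, which hence
  has a solution. Activity A only grows, so its efforts stay positive.
\<close>

lemma equilibrium_ex1: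
  assumes eq: "equilibrium G \<beta> \<delta> \<mu> (pA, pB) (x, y)" and le: "pA \<le> pA'" "pB' \<le> pB"
  shows "\<exists>!z. equilibrium G \<beta> \<delta> \<mu> (pA', pB') z"
proof -
  have lcp: "lcp_solution reduced (crowding *v pA - pB) y" and x: "x = own_inverse *v pA - crowding *v y"
    and pos: "\<And>i. 0 < x $ i"
    using eq by (auto simp: equilibrium_iff_lcp)
  have "reduced *v y + (crowding *v pA - pB) \<le> reduced *v y + (crowding *v pA' - pB')"
    using lcp_vector_mono[OF le] by (rule add_left_mono)
  then have "0 \<le> y" "0 \<le> reduced *v y + (crowding *v pA' - pB')"
    using lcp by (auto simp: lcp_solution_def intro: order_trans)
  then obtain y' where y': "lcp_solution reduced (crowding *v pA' - pB') y'"
    using lcp_solution_exists[OF reduced_pd] by blast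
  define x' where "x' = own_inverse *v pA' - crowding *v y'"
  have "y' \<le> y"
    by (rule lcp_solution_antimono[OF reduced_pd lcp y' lcp_vector_mono[OF le]])
  then have "x \<le> x'"
    unfolding x x'_def by (rule sustainable_effort_mono[OF le(1)])
  then have "0 < x' $ i" for i
    using pos[of i] by (auto simp: less_eq_vec_def intro: less_le_trans)
  then have "equilibrium G \<beta> \<delta> \<mu> (pA', pB') (x', y')"
    using y' by (simp add: equilibrium_iff_lcp x'_def)
  then show ?thesis
    using equilibrium_unique by blast
qed

text \<open>
  By the first order conditions the terms of the utility that are linear in the agent's own efforts
  amount to twice the quadratic cost; in the sum and the difference of the two efforts that cost is
  diagonal.
\<close>

lemma utility_at_equilibrium:
  assumes eq: "equilibrium G \<beta> \<delta> \<mu> (pA, pB) (x, y)"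
  shows "utility G \<beta> \<delta> \<mu> (x, y) (pA, pB) i =
    ((1 + \<beta>) * (x $ i + y $ i)\<^sup>2 + (1 - \<beta>) * (x $ i - y $ i)\<^sup>2) / 4"
proof -
  define r where "r = pA $ i + \<delta> * (G *v x) $ i + \<mu> * (G *v y) $ i"
  define s where "s = pB $ i + \<delta> * (G *v y) $ i + \<mu> * (G *v x) $ i"
  have "(own *v x + cross *v y) $ i = pA $ i" and "y $ i = 0 \<or> (own *v y + cross *v x) $ i = pB $ i"
    using eq unfolding equilibrium_iff_first_order by auto
  then have r: "r = x $ i + \<beta> * y $ i" and s: "y $ i = 0 \<or> s = y $ i + \<beta> * x $ i"
    by (auto simp: r_def s_def own_apply cross_apply algebra_simps)
  have sy: "s * y $ i = (y $ i + \<beta> * x $ i) * y $ i"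
    using s by auto
  have "utility G \<beta> \<delta> \<mu> (x, y) (pA, pB) i =
      r * x $ i + s * y $ i - (x $ i)\<^sup>2 / 2 - (y $ i)\<^sup>2 / 2 - \<beta> * x $ i * y $ i"
    using utility_deviate[of G i \<beta> \<delta> \<mu> x y "x $ i" "y $ i" pA pB] adjacency
    unfolding deviate_self r_def s_def by (simp add: adjacency_matrix_def)
  then show ?thesis
    unfolding sy r by (simp add: power2_eq_square field_simps)
qed

text \<open>
  Utility is an increasing function of \<open>x + y\<close> and \<open>\<bar>x - y\<bar>\<close>, so these two quantities are compared.
  The sum \<open>x + y\<close> solves the linear system of \<open>own + cross\<close> with right-hand side \<open>pA + pB\<close> plus the
  slack, and both of these increase. The difference \<open>x - y\<close> increases, as \<open>x\<close> increases and \<open>y\<close>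
  decreases. It also remains to see that \<open>(x' - y') + (x - y)\<close> is nonnegative, by the minimum
  principle for \<open>own - cross\<close>: where \<open>y'\<close> vanishes this follows from the comparison of the sums, and
  elsewhere both slacks vanish and the hypothesis on the price gaps applies.
\<close>

lemma utility_mono:
  assumes eq: "equilibrium G \<beta> \<delta> \<mu> (pA, pB) (x, y)"
    and eq': "equilibrium G \<beta> \<delta> \<mu> (pA', pB') (x', y')"
    and le: "pA \<le> pA'" "pB' \<le> pB"
    and sum: "pA + pB \<le> pA' + pB'"
    and gap: "0 \<le> (pA' - pB') + (pA - pB)"
  shows "utility G \<beta> \<delta> \<mu> (x, y) (pA, pB) i \<le> utility G \<beta> \<delta> \<mu> (x', y') (pA', pB') i"
proof -
  let ?P = "(1 + \<beta>) *\<^sub>R mat 1 - (\<delta> + \<mu>) *\<^sub>R G" and ?M = "(1 - \<beta>) *\<^sub>R mat 1 - (\<delta> - \<mu>) *\<^sub>R G"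
  have pos: "0 < x $ i" "0 < x' $ i" "0 \<le> y $ i" "0 \<le> y' $ i" for i
    using eq eq' by (auto simp: equilibrium_iff_first_order less_eq_vec_def)
  have A: "own *v x + cross *v y = pA" "own *v x' + cross *v y' = pA'"
    using eq eq' by (auto simp: equilibrium_iff_first_order)
  note mono = equilibrium_mono[OF eq eq' le]
  have "0 \<le> (pA' + pB' - (pA + pB)) + (own *v y' + cross *v x' - pB' - (own *v y + cross *v x - pB))"
    using sum mono(3) by (intro add_nonneg_nonneg) simp_all
  also have "\<dots> = ?P *v ((x' + y') - (x + y))"
    unfolding plus_apply A[symmetric]
    by (simp add: matrix_vector_right_distrib matrix_vector_mult_diff_distrib algebra_simps)
  finally have "0 \<le> (x' + y') - (x + y)"
    by (rule positive_definite_Z_nonneg[OF plus_pd])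
  then have s: "x $ j + y $ j \<le> x' $ j + y' $ j" for j
    by (simp add: less_eq_vec_def)
  have "0 \<le> (x' - y') + (x - y)"
  proof (rule positive_definite_Z_minimum_principle[OF minus_pd])
    fix j
    show "0 \<le> ((x' - y') + (x - y)) $ j \<or> 0 \<le> (?M *v ((x' - y') + (x - y))) $ j"
    proof (cases "y' $ j = 0")
      case True
      then have "0 \<le> ((x' - y') + (x - y)) $ j"
        using s[of j] pos[of j] by simp
      then show ?thesis ..
    next
      case False
      then have "0 < y $ j"
        using mono(1) pos(4)[of j] by (metis less_eq_vec_def order_le_less less_le_trans)
      then have "(own *v y + cross *v x) $ j = pB $ j" "(own *v y' + cross *v x') $ j = pB' $ j"
        using eq eq' False by (auto simp: equilibrium_iff_first_order less_le)
      moreover have "(own *v x + cross *v y) $ j = pA $ j" "(own *v x' + cross *v y') $ j = pA' $ j"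
        by (simp_all only: A)
      ultimately have "(?M *v ((x' - y') + (x - y))) $ j = ((pA' - pB') + (pA - pB)) $ j"
        unfolding minus_apply
        by (simp add: matrix_vector_right_distrib matrix_vector_mult_diff_distrib)
      then show ?thesis
        using gap by (simp only: less_eq_vec_def) simp
    qed
  qed
  then have "\<bar>x $ i - y $ i\<bar> \<le> x' $ i - y' $ i"
    using mono(1,2) by (simp add: less_eq_vec_def abs_le_iff) (smt (verit))
  then have "(x $ i - y $ i)\<^sup>2 \<le> (x' $ i - y' $ i)\<^sup>2"
    by (intro abs_le_square_iff[THEN iffD1]) linarith
  moreover have "(x $ i + y $ i)\<^sup>2 \<le> (x' $ i + y' $ i)\<^sup>2"
    using s[of i] pos[of i] by (intro power_mono) auto
  ultimately show ?thesis
    unfolding utility_at_equilibrium[OF eq] utility_at_equilibrium[OF eq']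
    using params by (intro divide_right_mono add_mono mult_left_mono) auto
qed

text \<open>
  The equation for \<open>\<rho>0\<close> says that at the prices \<open>pA0 + \<rho>0 + b0\<close> and \<open>pB0 - \<rho>0\<close> the interior first
  order conditions are solved by \<open>(z, 0)\<close>. Eliminating \<open>z\<close>, the vector of the complementarity
  problem is exactly zero there. It is therefore nonnegative at \<open>(pA, pB)\<close>, where \<open>0\<close> is then the
  solution. It would not be enough that the interior formula for the efforts in activity B is
  nonpositive at \<open>(pA, pB)\<close>.
\<close>

lemma zero_unsustainable_effort:
  assumes \<rho>0: "\<rho>0 = (1 / 2) *\<^sub>R (matrix_inv (M_minus G \<beta> \<delta> \<mu>) *v
               ((M_plus G \<beta> \<delta> \<mu> + M_minus G \<beta> \<delta> \<mu>) *v pB0 - M_Delta G \<beta> \<delta> \<mu> *v pA0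
                - M_Delta G \<beta> \<delta> \<mu> *v b0))"
    and eq: "equilibrium G \<beta> \<delta> \<mu> (pA, pB) (x, y)"
    and le: "pA0 + \<rho>0 + b0 \<le> pA" "pB \<le> pB0 - \<rho>0"
  shows "y = 0"
proof -
  let ?P = "(1 + \<beta>) *\<^sub>R mat 1 - (\<delta> + \<mu>) *\<^sub>R G" and ?M = "(1 - \<beta>) *\<^sub>R mat 1 - (\<delta> - \<mu>) *\<^sub>R G"
  let ?p = "M_plus G \<beta> \<delta> \<mu>" and ?m = "M_minus G \<beta> \<delta> \<mu>"
  have inv: "?P *v (?p *v v) = v" "?M *v (?m *v v) = v" "?m *v (?M *v v) = v" for v
    unfolding M_plus_def M_minus_def
    using positive_definite_Z_matrix_inv[OF plus_pd] positive_definite_Z_matrix_inv[OF minus_pd]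
    by blast+
  have "invertible ?m"
    unfolding invertible_def matrix_eq by (metis inv(2,3) matrix_vector_mul_assoc matrix_vector_mul_lid)
  then have "?m ** matrix_inv ?m = mat 1"
    unfolding invertible_def matrix_inv_def by (rule someI2_ex) simp
  then have m_inv: "?m *v (matrix_inv ?m *v v) = v" for v
    by (simp add: matrix_vector_mul_assoc)
  \<comment> \<open>In an interior equilibrium at the prices \<open>pA0 + \<rho>0 + b0\<close> and \<open>pB0 - \<rho>0\<close>, the sum of the
    efforts is given by \<open>?p\<close> and their difference by \<open>?m\<close>. Both turn out to be \<open>z\<close>.\<close>
  define z where "z = ?p *v (pA0 + pB0 + b0)"
  have "2 *\<^sub>R (?m *v \<rho>0) = (?p + ?m) *v pB0 - M_Delta G \<beta> \<delta> \<mu> *v pA0 - M_Delta G \<beta> \<delta> \<mu> *v b0"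
    unfolding \<rho>0 by (simp add: matrix_vector_mult_scaleR m_inv)
  then have "?m *v (pA0 - pB0 + 2 *\<^sub>R \<rho>0 + b0) = z"
    unfolding z_def M_Delta_def
    by (simp add: algebra_simps matrix_vector_right_distrib)
  then have "?M *v z = pA0 - pB0 + 2 *\<^sub>R \<rho>0 + b0" "?P *v z = pA0 + pB0 + b0"
    using inv(2) z_def inv(1) by metis+
  then have minus: "own *v z - cross *v z = pA0 - pB0 + 2 *\<^sub>R \<rho>0 + b0"
    and plus: "own *v z + cross *v z = pA0 + pB0 + b0"
    unfolding plus_apply minus_apply .
  have "2 *\<^sub>R (own *v z) = 2 *\<^sub>R (pA0 + \<rho>0 + b0)"
    using arg_cong2[OF plus minus, of "(+)"] by (simp add: algebra_simps scaleR_2)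
  then have Tz: "own *v z = pA0 + \<rho>0 + b0" by simp
  then have Cz: "cross *v z = pB0 - \<rho>0"
    using plus by (simp add: algebra_simps)
  have "crowding *v (pA0 + \<rho>0 + b0) = cross *v z"
    unfolding Tz[symmetric] cross_own_inverse[symmetric] by simp
  then have "0 \<le> crowding *v pA - pB"
    using lcp_vector_mono[OF le] Cz by simp
  then have "lcp_solution reduced (crowding *v pA - pB) 0"
    by (simp add: lcp_solution_def)
  moreover have y: "lcp_solution reduced (crowding *v pA - pB) y"
    using eq by (simp add: equilibrium_iff_lcp)
  ultimately have "y \<le> 0"
    by (intro lcp_solution_antimono[OF reduced_pd _ _ order_refl])
  moreover have "0 \<le> y"
    using y by (simp add: lcp_solution_def)
  ultimately show "y = 0"
    by simp
qed

end

section \<open>The policy of maximum penalties and premiums\<close>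

lemma (in network_game) outcome_eq:
  assumes "equilibrium G \<beta> \<delta> \<mu> p z"
  shows "outcome G \<beta> \<delta> \<mu> p = z"
  unfolding outcome_def using assms equilibrium_unique by blast

theorem theorem6:
  fixes G :: "real ^ 'n ^ 'n"
    and \<beta> \<delta> \<mu> \<tau>B :: real
    and pA0 pB0 xA0 xB0 \<rho>max b :: "real ^ 'n"
  assumes "adjacency_matrix G"
    and "0 < \<beta>" "\<beta> < 1" "0 < \<delta>" "0 < \<mu>"
    and "0 \<le> pA0" "0 \<le> pB0"
    and "equilibrium G \<beta> \<delta> \<mu> (pA0, pB0) (xA0, xB0)"
    and "0 \<le> \<tau>B" "0 \<le> \<rho>max" "\<rho>max \<le> pB0" "0 \<le> b"
    and "max (\<bar>\<delta> + \<mu>\<bar> / (1 + \<beta>)) (\<bar>\<delta> - \<mu>\<bar> / (1 - \<beta>)) * spectral_radius G < 1"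
    and "\<mu> < \<beta> * \<delta>"
    and "\<forall>i. 0 < xA0 $ i" "\<forall>i. 0 < xB0 $ i"
  shows "(\<forall>p. price_constraints (pA0, pB0) \<rho>max b p \<longrightarrow> (\<exists>!x. equilibrium G \<beta> \<delta> \<mu> p x)) \<and>
     ((\<exists>p. feasible G \<beta> \<delta> \<mu> (pA0, pB0) \<rho>max b \<tau>B p) \<longrightarrow>
           is_arg_min (total_effort_B G \<beta> \<delta> \<mu>) (feasible G \<beta> \<delta> \<mu> (pA0, pB0) \<rho>max b \<tau>B)
             (max_policy (pA0, pB0) \<rho>max b)) \<and>
     (\<forall>\<rho>0 b0. \<rho>0 = (1 / 2) *\<^sub>R (matrix_inv (M_minus G \<beta> \<delta> \<mu>) *v
               ((M_plus G \<beta> \<delta> \<mu> + M_minus G \<beta> \<delta> \<mu>) *v pB0 - M_Delta G \<beta> \<delta> \<mu> *v pA0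
                - M_Delta G \<beta> \<delta> \<mu> *v b0)) \<longrightarrow>
           \<rho>0 \<le> \<rho>max \<longrightarrow> b0 \<le> b \<longrightarrow>
           (\<forall>i. snd (outcome G \<beta> \<delta> \<mu> (max_policy (pA0, pB0) \<rho>max b)) $ i = 0) \<and>
           total_effort_B G \<beta> \<delta> \<mu> (max_policy (pA0, pB0) \<rho>max b) = 0) \<and>
     (pB0 - pA0 \<le> \<rho>max + (1 / 2) *\<^sub>R b \<longrightarrow>
           ((\<exists>p. feasible G \<beta> \<delta> \<mu> (pA0, pB0) \<rho>max b \<tau>B p) \<longrightarrow>
              is_arg_max (welfare G \<beta> \<delta> \<mu>) (feasible G \<beta> \<delta> \<mu> (pA0, pB0) \<rho>max b \<tau>B)
                (max_policy (pA0, pB0) \<rho>max b)) \<and>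
           (\<forall>i. utility G \<beta> \<delta> \<mu> (xA0, xB0) (pA0, pB0) i
                \<le> utility G \<beta> \<delta> \<mu> (outcome G \<beta> \<delta> \<mu> (max_policy (pA0, pB0) \<rho>max b))
                     (max_policy (pA0, pB0) \<rho>max b) i))"
proof -
  interpret network_game G \<beta> \<delta> \<mu>
    using assms by unfold_locales auto
  let ?admissible = "price_constraints (pA0, pB0) \<rho>max b"
  let ?u = "utility G \<beta> \<delta> \<mu>"
  define pA pB where "pA = pA0 + \<rho>max + b" and "pB = pB0 - \<rho>max"
  have max: "max_policy (pA0, pB0) \<rho>max b = (pA, pB)"
    by (simp add: pA_def pB_def)
  have nonneg: "0 \<le> \<rho>max $ i" "0 \<le> b $ i" for i
    using assms(10,12) by (auto simp: less_eq_vec_def)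
  have exists: "\<exists>!x. equilibrium G \<beta> \<delta> \<mu> p x" if "?admissible p" for p
    using that equilibrium_ex1[OF assms(8), of "fst p" "snd p"] by (cases p) simp
  have admissible: "?admissible (pA0, pB0)" "?admissible (pA, pB)"
    using nonneg by (auto simp: less_eq_vec_def pA_def pB_def)
  obtain x y where eq: "equilibrium G \<beta> \<delta> \<mu> (pA, pB) (x, y)"
    using exists[OF admissible(2)] by auto
  note outcome = outcome_eq[OF eq]
  \<comment> \<open>The policy is extreme in every direction that matters: largest price in A, smallest in B,
    and, as the whole budget is spent, largest price sum.\<close>
  have extreme: "qA \<le> pA" "pB \<le> qB" "qA + qB \<le> pA + pB" if "?admissible (qA, qB)" for qA qB
  proof -
    have q: "pB0 $ i - \<rho>max $ i \<le> qB $ i" "qA $ i + qB $ i \<le> pA0 $ i + pB0 $ i + b $ i" for i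
      using that by (auto simp: less_eq_vec_def)
    have "qA $ i \<le> pA $ i" "pB $ i \<le> qB $ i" "qA $ i + qB $ i \<le> pA $ i + pB $ i" for i
      using q[of i] by (auto simp: pA_def pB_def)
    then show "qA \<le> pA" "pB \<le> qB" "qA + qB \<le> pA + pB"
      by (simp_all add: less_eq_vec_def)
  qed
  have effort: "total_effort_B G \<beta> \<delta> \<mu> (pA, pB) \<le> total_effort_B G \<beta> \<delta> \<mu> q"
    if q: "?admissible q" for q
  proof (cases q)
    case (Pair qA qB)
    then obtain v w where eq': "equilibrium G \<beta> \<delta> \<mu> (qA, qB) (v, w)"
      using exists[OF q] by auto
    have "y \<le> w"
      using equilibrium_mono(1)[OF eq' eq] extreme q Pair by blast
    then show ?thesis
      unfolding total_effort_B_def outcome Pair outcome_eq[OF eq']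
      by (auto simp: less_eq_vec_def intro: sum_mono)
  qed
  have feasible_max: "feasible G \<beta> \<delta> \<mu> (pA0, pB0) \<rho>max b \<tau>B (pA, pB)"
    if "feasible G \<beta> \<delta> \<mu> (pA0, pB0) \<rho>max b \<tau>B q" for q
    using that effort[of q] admissible(2) unfolding feasible_def by linarith
  have zero: "y = 0"
    if "\<rho>0 = (1 / 2) *\<^sub>R (matrix_inv (M_minus G \<beta> \<delta> \<mu>) *v
               ((M_plus G \<beta> \<delta> \<mu> + M_minus G \<beta> \<delta> \<mu>) *v pB0 - M_Delta G \<beta> \<delta> \<mu> *v pA0
                - M_Delta G \<beta> \<delta> \<mu> *v b0))" "\<rho>0 \<le> \<rho>max" "b0 \<le> b" for \<rho>0 b0
    using that(2,3)
    by (intro zero_unsustainable_effort[OF that(1) eq])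
      (auto simp: pA_def pB_def intro: add_mono diff_mono)
  have utility: "?u (outcome G \<beta> \<delta> \<mu> q) q i \<le> ?u (outcome G \<beta> \<delta> \<mu> (pA, pB)) (pA, pB) i"
    if suff: "pB0 - pA0 \<le> \<rho>max + (1 / 2) *\<^sub>R b" and q: "?admissible q" for q i
  proof (cases q)
    case (Pair qA qB)
    then obtain v w where eq': "equilibrium G \<beta> \<delta> \<mu> (qA, qB) (v, w)"
      using exists[OF q] by auto
    \<comment> \<open>The sufficiency condition states that \<open>pA - pB\<close> is at least \<open>pB0 - pA0\<close>, and the price
      gap in favour of B is at most \<open>pB0 - pA0\<close> under every admissible policy.\<close>
    have "0 \<le> (pA - pB) + (qA - qB)"
      unfolding less_eq_vec_def
    proof
      fix i
      have "pB0 $ i - pA0 $ i \<le> \<rho>max $ i + b $ i / 2" "pA0 $ i \<le> qA $ i" "qB $ i \<le> pB0 $ i"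
        using suff q Pair by (auto simp: less_eq_vec_def)
      then show "(0 :: real ^ 'n) $ i \<le> ((pA - pB) + (qA - qB)) $ i"
        by (simp add: pA_def pB_def)
    qed
    then show ?thesis
      unfolding Pair outcome outcome_eq[OF eq']
      using extreme q Pair by (intro utility_mono[OF eq' eq]) auto
  qed
  have welfare: "welfare G \<beta> \<delta> \<mu> q \<le> welfare G \<beta> \<delta> \<mu> (pA, pB)"
    if "pB0 - pA0 \<le> \<rho>max + (1 / 2) *\<^sub>R b" "?admissible q" for q
    unfolding welfare_def using utility[OF that] by (rule sum_mono)
  show ?thesis
    unfolding max
  proof (intro conjI allI impI)
    show "\<exists>!x. equilibrium G \<beta> \<delta> \<mu> p x" if "?admissible p" for p
      using that by (rule exists)
    show "is_arg_min (total_effort_B G \<beta> \<delta> \<mu>) (feasible G \<beta> \<delta> \<mu> (pA0, pB0) \<rho>max b \<tau>B) (pA, pB)"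
      if "\<exists>p. feasible G \<beta> \<delta> \<mu> (pA0, pB0) \<rho>max b \<tau>B p"
      using that feasible_max effort by (auto simp: is_arg_min_def feasible_def not_less)
    show "is_arg_max (welfare G \<beta> \<delta> \<mu>) (feasible G \<beta> \<delta> \<mu> (pA0, pB0) \<rho>max b \<tau>B) (pA, pB)"
      if "\<exists>p. feasible G \<beta> \<delta> \<mu> (pA0, pB0) \<rho>max b \<tau>B p" "pB0 - pA0 \<le> \<rho>max + (1 / 2) *\<^sub>R b"
      using that(1) feasible_max welfare[OF that(2)]
      by (auto simp: is_arg_max_def feasible_def not_less)
    show "?u (xA0, xB0) (pA0, pB0) i \<le> ?u (outcome G \<beta> \<delta> \<mu> (pA, pB)) (pA, pB) i"
      if "pB0 - pA0 \<le> \<rho>max + (1 / 2) *\<^sub>R b" for i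
      using utility[OF that admissible(1)] unfolding outcome_eq[OF assms(8)] .
  next
    fix \<rho>0 b0 :: "real ^ 'n" and i
    assume "\<rho>0 = (1 / 2) *\<^sub>R (matrix_inv (M_minus G \<beta> \<delta> \<mu>) *v
               ((M_plus G \<beta> \<delta> \<mu> + M_minus G \<beta> \<delta> \<mu>) *v pB0 - M_Delta G \<beta> \<delta> \<mu> *v pA0
                - M_Delta G \<beta> \<delta> \<mu> *v b0))" "\<rho>0 \<le> \<rho>max" "b0 \<le> b"
    then have "y = 0"
      by (rule zero)
    then show "snd (outcome G \<beta> \<delta> \<mu> (pA, pB)) $ i = 0" "total_effort_B G \<beta> \<delta> \<mu> (pA, pB) = 0"
      by (simp_all add: outcome total_effort_B_def)
  qed
qed

end
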